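(* Let $r\in(0,1]$ be given. If $0\le\alpha<1$ and $\alpha<\frac{1-r}{r^2}$, then each function $f\in\mathcal{BS}(\alpha)$ maps the disc $\{z:|z|<r\}$ onto a starlike domain.
   Context: $\Delta=\{z\in\mathbb{C}:|z|<1\}$, and $\mathcal{A}$ is the class of analytic functions $f$ on $\Delta$ with $f(0)=0$ and $f'(0)=1$. For analytic functions $f,g$ on $\Delta$, $f\prec g$ ($f$ is subordinate to $g$) means that there is an analytic function $w$ on $\Delta$ with $w(0)=0$ and $|w(z)|<1$ for all $z\in\Delta$ such that $f(z)=g(w(z))$ for all $z\in\Delta$. For $0\le\alpha<1$, $\mathcal{BS}(\alpha)$ is the class of $f\in\mathcal{A}$ such that $\frac{zf'(z)}{f(z)}-1\prec\frac{z}{1-\alpha z^2}$ in $\Delta$ (in particular $zf'(z)/f(z)$ is analytic in $\Delta$, with value $1$ at $z=0$). A starlike domain means a domain that is starlike with respect to the origin. *)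

theory Defs
  imports "HOL-Complex_Analysis.Complex_Analysis"
begin

abbreviation unit_disc :: "complex set" where
  "unit_disc \<equiv> ball 0 1"

definition class_A :: "(complex \<Rightarrow> complex) set" where
  "class_A = {f. f holomorphic_on unit_disc \<and> f 0 = 0 \<and> deriv f 0 = 1}"

definition subordinate :: "(complex \<Rightarrow> complex) \<Rightarrow> (complex \<Rightarrow> complex) \<Rightarrow> bool"
  where
  "subordinate f g \<longleftrightarrow>
     f holomorphic_on unit_disc \<and> g holomorphic_on unit_disc \<and>
     (\<exists>w. w holomorphic_on unit_disc \<and> w 0 = 0 \<and>
          (\<forall>z\<in>unit_disc. norm (w z) < 1 \<and> f z = g (w z)))"

text \<open>
  The quotient \<open>z f'(z) / f(z)\<close>, with its removable singularity at the origin filled in: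
  for \<open>f\<close> in \<open>class_A\<close> it tends to \<open>1\<close> there. At a zero of \<open>f\<close> other than the origin the formula
  takes the value \<open>0\<close> (division by zero), but the quotient is unbounded near such a zero, so
  requiring it to be holomorphic on the disc excludes these zeros; see
  \<open>holomorphic_log_quotient_nonzero\<close>.
\<close>

definition log_quotient :: "(complex \<Rightarrow> complex) \<Rightarrow> complex \<Rightarrow> complex" where
  "log_quotient f z = (if z = 0 then 1 else z * deriv f z / f z)"

definition class_BS :: "real \<Rightarrow> (complex \<Rightarrow> complex) set" where
  "class_BS \<alpha> = {f \<in> class_A.
     subordinate (\<lambda>z. log_quotient f z - 1) (\<lambda>z. z / (1 - of_real \<alpha> * z\<^sup>2))}"

text \<open>The library predicate \<open>starlike\<close> leaves the centre unspecified; here it is the origin.\<close>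

definition starlike_domain :: "complex set \<Rightarrow> bool" where
  "starlike_domain S \<longleftrightarrow>
     open S \<and> connected S \<and> 0 \<in> S \<and> (\<forall>w\<in>S. closed_segment 0 w \<subseteq> S)"

lemma holomorphic_log_quotient_nonzero:
  assumes f: "f \<in> class_A" and hol: "log_quotient f holomorphic_on unit_disc"
    and a: "a \<in> unit_disc" "a \<noteq> 0"
  shows "f a \<noteq> 0"
proof
  assume fa: "f a = 0"
  have fh: "f holomorphic_on unit_disc" and d0: "deriv f 0 = 1"
    using f by (auto simp: class_A_def)
  have "\<not> f constant_on unit_disc"
  proof
    assume "f constant_on unit_disc"
    then obtain c where c: "\<And>z. z \<in> unit_disc \<Longrightarrow> f z = c"
      by (auto simp: constant_on_def)
    have "eventually (\<lambda>z. f z = c) (nhds 0)"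
      using eventually_nhds_in_open[of unit_disc 0] by (auto elim!: eventually_mono intro: c)
    then have "deriv f 0 = deriv (\<lambda>_. c) 0"
      by (rule deriv_cong_ev) simp
    with d0 show False by simp
  qed
  then obtain g \<rho> n where n: "0 < n" and \<rho>: "0 < \<rho>" "ball a \<rho> \<subseteq> unit_disc"
    and gh: "g holomorphic_on ball a \<rho>"
    and fg: "\<And>w. w \<in> ball a \<rho> \<Longrightarrow> f w = (w - a) ^ n * g w"
    and g0: "\<And>w. w \<in> ball a \<rho> \<Longrightarrow> g w \<noteq> 0"
    using holomorphic_factor_zero_nonconstant[OF fh _ _ a(1) fa] by (metis open_ball connected_ball)
  let ?p = "log_quotient f"
  define h where "h = (\<lambda>w. ?p w * (w - a) * g w - w * (of_nat n * g w + (w - a) * deriv g w))"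
  have h_zero: "h w = 0" if w: "w \<in> ball a \<rho>" "w \<noteq> a" "w \<noteq> 0" for w
  proof -
    have "(g has_field_derivative deriv g w) (at w)"
      using gh w(1) holomorphic_derivI open_ball by blast
    then have "((\<lambda>w. (w - a) ^ n * g w) has_field_derivative
        of_nat n * (w - a) ^ (n - 1) * g w + (w - a) ^ n * deriv g w) (at w)"
      by (auto intro!: derivative_eq_intros)
    moreover have "eventually (\<lambda>w. f w = (w - a) ^ n * g w) (nhds w)"
      using eventually_nhds_in_open[of "ball a \<rho>" w] w(1) by (auto elim!: eventually_mono intro: fg)
    ultimately have "deriv f w = of_nat n * (w - a) ^ (n - 1) * g w + (w - a) ^ n * deriv g w"
      by (metis DERIV_imp_deriv deriv_cong_ev)
    moreover obtain m where m: "n = Suc m"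
      using n gr0_implies_Suc by blast
    ultimately have D: "deriv f w = (w - a) ^ m * (of_nat n * g w + (w - a) * deriv g w)"
      by (simp add: algebra_simps)
    have F: "f w = (w - a) ^ m * ((w - a) * g w)"
      using fg[OF w(1)] m by simp
    have "?p w * ((w - a) * g w) = w * (of_nat n * g w + (w - a) * deriv g w)"
      using w g0[OF w(1)] by (simp add: log_quotient_def D F)
    then show ?thesis
      by (simp add: h_def mult.assoc)
  qed
  have "continuous_on (ball a \<rho>) h"
    unfolding h_def using \<rho> hol gh
    by (intro continuous_intros holomorphic_on_imp_continuous_on holomorphic_deriv)
       (auto intro: holomorphic_on_subset)
  then have "isCont h a"
    using \<rho>(1) by (simp add: continuous_on_eq_continuous_at)
  then have "(h \<longlongrightarrow> h a) (at a)"
    by (simp add: isCont_def)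
  moreover have "eventually (\<lambda>w. h w = 0) (at a)"
  proof (rule eventually_mono)
    show "eventually (\<lambda>w. w \<in> ball a \<rho> - {0} - {a}) (at a)"
      using \<rho>(1) a(2) by (intro eventually_at_in_open open_delete) auto
  qed (auto intro: h_zero)
  then have "(h \<longlongrightarrow> 0) (at a)"
    by (rule tendsto_eventually)
  ultimately have "h a = 0"
    by (metis LIM_unique)
  then show False
    using a(2) n g0[of a] \<rho>(1) by (simp add: h_def)
qed

end

theory Submission
  imports Defs
begin

text \<open>
  The proof has two independent halves.

  The analytic half is an estimate: by Schwarz's lemma the function \<open>w\<close> that realises the
  subordination satisfies \<open>|w z| \<le> |z|\<close>, so on \<open>|z| < r\<close> the quotient \<open>p z = z f'(z) / f(z)\<close>
  differs from \<open>1\<close> by at most \<open>|w| / (1 - \<alpha> |w|\<^sup>2)\<close>. The bound on \<open>\<alpha>\<close>, which reads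
  \<open>r < 1 - \<alpha> r\<^sup>2\<close>, keeps this below \<open>1\<close>; hence \<open>Re p > 0\<close> there.

  The geometric half (\<open>starlike_domain_image_ball\<close>) is the classical criterion that \<open>Re p > 0\<close>
  makes the image starlike. Instead of passing through univalence, it follows preimages along a
  segment towards the origin. If \<open>z\<close> moves so that \<open>f z = s c\<close> with \<open>s > 0\<close> and \<open>c\<close> fixed, then
  \<open>d |z|\<^sup>2 / ds = (2 |z|\<^sup>2 / s) Re (1 / p z) > 0\<close>: shrinking \<open>s\<close> pulls the preimage closer to
  the origin (\<open>smaller_multiple_has_preimage\<close>). It therefore never leaves the compact disc it
  started in, and a compactness argument carries it down the whole segment.
\<close>

text \<open>
  The local step towards the origin. The condition on the real part also forces
  \<open>z \<noteq> 0\<close>, \<open>f z \<noteq> 0\<close> and \<open>deriv f z \<noteq> 0\<close>, since division by zero would give the value \<open>0\<close>; so a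
  local inverse of \<open>f\<close> exists at \<open>f z\<close>, and the curve of preimages is its image of the ray.
\<close>

lemma smaller_multiple_has_preimage:
  fixes f :: "complex \<Rightarrow> complex" and t \<tau> :: real
  assumes hol: "f holomorphic_on S" and "open S" "z \<in> S"
    and pos: "Re (z * deriv f z / f z) > 0"
    and fz: "f z = of_real t * c" and "0 < t" "\<tau> < t"
  obtains s z' where "\<tau> < s" "s < t" "norm z' < norm z" "f z' = of_real s * c"
proof -
  have nz: "z \<noteq> 0" "f z \<noteq> 0" "deriv f z \<noteq> 0"
    using pos by auto
  obtain e where e: "e > 0" "ball z e \<subseteq> S" "inj_on f (ball z e)"
    using has_complex_derivative_locally_injective[OF hol \<open>z \<in> S\<close> \<open>open S\<close> nz(3)] by blast
  define U where "U = ball z e"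
  have holU: "f holomorphic_on U" and U: "open U" "z \<in> U" "inj_on f U"
    using e hol by (auto simp: U_def intro: holomorphic_on_subset)
  obtain g where g: "g holomorphic_on (f ` U)"
      "\<And>x. x \<in> U \<Longrightarrow> deriv f x * deriv g (f x) = 1"
      "\<And>x. x \<in> U \<Longrightarrow> g (f x) = x"
    using holomorphic_has_inverse[OF holU U(1) U(3)] by metis
  have openfU: "open (f ` U)"
    using open_mapping_thm3[OF holU U(1) U(3)] .
  define \<phi> where "\<phi> s = g (of_real s * c)" for s :: real
  have "(g has_field_derivative deriv g (of_real t * c)) (at (of_real t * c))"
    using g(1) openfU U(2) fz by (metis holomorphic_derivI imageI)
  moreover have "deriv g (of_real t * c) = 1 / deriv f z"
    using g(2)[OF U(2)] fz nz(3) by (simp add: field_simps)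
  ultimately have g': "(g has_field_derivative 1 / deriv f z) (at (of_real t * c))"
    by simp
  have lin: "((\<lambda>s. of_real s * c) has_vector_derivative c) (at t)"
    by (auto intro!: derivative_eq_intros)
  have \<phi>': "(\<phi> has_vector_derivative c / deriv f z) (at t)"
    using field_vector_diff_chain_at[OF lin g'] by (simp add: \<phi>_def[abs_def] o_def)
  have \<phi>t: "\<phi> t = z"
    using g(3)[OF U(2)] fz by (simp add: \<phi>_def)
  have N': "((\<lambda>s. \<phi> s \<bullet> \<phi> s) has_real_derivative 2 * (z \<bullet> (c / deriv f z))) (at t)"
    using \<phi>' \<phi>t unfolding has_vector_derivative_def has_field_derivative_def
    by (auto intro!: derivative_eq_intros simp: inner_commute algebra_simps fun_eq_iff)
  \<comment> \<open>The derivative of \<open>|\<phi>|\<^sup>2\<close> at \<open>t\<close> is the positive number \<open>2 |z|\<^sup>2 Re (1 / p) / t\<close>.\<close>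
  have "z \<bullet> (c / deriv f z) = Re (cnj z * (c / deriv f z))"
    by (simp add: inner_complex_def del: times_divide_eq_right)
  also have "cnj z * (c / deriv f z) = of_real ((norm z)\<^sup>2 / t) * inverse (z * deriv f z / f z)"
    using nz fz \<open>0 < t\<close>
    by (simp add: field_simps complex_norm_square[unfolded of_real_power, symmetric])
  also have "Re \<dots> = (norm z)\<^sup>2 / t * Re (inverse (z * deriv f z / f z))"
    by (simp only: times_complex.sel Re_complex_of_real Im_complex_of_real mult_zero_left diff_zero)
  also have "\<dots> > 0"
    unfolding inverse_complex.sel using pos nz \<open>0 < t\<close>
    by (intro mult_pos_pos divide_pos_pos add_pos_nonneg) auto
  finally have "2 * (z \<bullet> (c / deriv f z)) > 0" by simp
  from DERIV_pos_inc_left[OF N' this] obtain d where d: "d > 0"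
    "\<And>h. 0 < h \<Longrightarrow> h < d \<Longrightarrow> \<phi> (t - h) \<bullet> \<phi> (t - h) < \<phi> t \<bullet> \<phi> t"
    by blast
  have "of_real t * c \<in> f ` U"
    using U(2) fz by (metis imageI)
  moreover have "isCont (\<lambda>s::real. of_real s * c) t"
    by (intro continuous_intros)
  ultimately have "eventually (\<lambda>s::real. of_real s * c \<in> f ` U) (nhds t)"
    using openfU by (auto simp: isCont_def tendsto_def eventually_nhds_conv_at)
  then obtain d' where d': "d' > 0" "\<And>s. dist s t < d' \<Longrightarrow> of_real s * c \<in> f ` U"
    by (auto simp: eventually_nhds_metric)
  define h where "h = min (min d d') (t - \<tau>) / 2"
  have h: "0 < h" "h < d" "h < d'" "h < t - \<tau>"
    using d(1) d'(1) \<open>\<tau> < t\<close> by (auto simp: h_def)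
  show ?thesis
  proof
    show "\<tau> < t - h" "t - h < t" using h by auto
    show "norm (\<phi> (t - h)) < norm z"
      using d(2)[OF h(1,2)] \<phi>t by (simp add: norm_lt)
    have "of_real (t - h) * c \<in> f ` U"
      using h by (intro d'(2)) (simp add: dist_real_def)
    then show "f (\<phi> (t - h)) = of_real (t - h) * c"
      unfolding \<phi>_def using g(3) by auto
  qed
qed

text \<open>
  To see that \<open>\<tau> f z\<^sub>0\<close> is a value for given \<open>0 < \<tau> \<le> 1\<close> and \<open>f z\<^sub>0 \<noteq> 0\<close>, note that
  among the multiples of \<open>f z\<^sub>0\<close> with factor in \<open>[\<tau>, 1]\<close> that have a preimage in the
  compact disc \<open>cball 0 |z\<^sub>0|\<close> there is one with least factor. By the local step it can only be \<open>\<tau>\<close>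
  itself.
\<close>

lemma starlike_domain_image_ball:
  fixes f :: "complex \<Rightarrow> complex"
  assumes hol: "f holomorphic_on ball 0 r" and "0 < r" "f 0 = 0"
    and pos: "\<And>z. z \<in> ball 0 r \<Longrightarrow> z \<noteq> 0 \<Longrightarrow> Re (z * deriv f z / f z) > 0"
  shows "starlike_domain (f ` ball 0 r)"
  unfolding starlike_domain_def
proof (intro conjI ballI subsetI)
  have cont: "continuous_on (ball 0 r) f"
    using hol by (rule holomorphic_on_imp_continuous_on)
  have nonconst: "\<not> f constant_on ball 0 r"
  proof
    assume "f constant_on ball 0 r"
    moreover have half: "of_real (r / 2) \<in> ball (0 :: complex) r" "of_real (r / 2) \<noteq> (0 :: complex)"
      and "0 \<in> ball (0 :: complex) r"
      using \<open>0 < r\<close> by auto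
    ultimately have "f (of_real (r / 2)) = 0"
      using \<open>f 0 = 0\<close> unfolding constant_on_def by metis
    then show False using pos[OF half] by simp
  qed
  show "open (f ` ball 0 r)"
    using open_mapping_thm[OF hol _ _ _ order_refl nonconst] by simp
  show "connected (f ` ball 0 r)"
    using cont by (intro connected_continuous_image) auto
  show "0 \<in> f ` ball 0 r"
    using \<open>0 < r\<close> \<open>f 0 = 0\<close> by (intro rev_image_eqI[of 0]) auto
  fix w x assume "w \<in> f ` ball 0 r" "x \<in> closed_segment 0 w"
  then obtain z\<^sub>0 \<tau> where z\<^sub>0: "z\<^sub>0 \<in> ball 0 r" and \<tau>: "0 \<le> \<tau>" "\<tau> \<le> 1"
    and x: "x = of_real \<tau> * f z\<^sub>0"
    by (auto simp: in_segment scaleR_conv_of_real)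
  show "x \<in> f ` ball 0 r"
  proof (cases "\<tau> = 0 \<or> f z\<^sub>0 = 0")
    case True
    then have "x = 0" using x by auto
    then show ?thesis using \<open>0 \<in> f ` ball 0 r\<close> by simp
  next
    case False
    define K where "K = cball (0 :: complex) (norm z\<^sub>0)"
    have K: "K \<subseteq> ball 0 r" "z\<^sub>0 \<in> K" "compact K"
      using z\<^sub>0 by (auto simp: K_def)
    define T where "T = {\<tau>..1} \<inter> (\<lambda>s. of_real s * f z\<^sub>0) -` (f ` K)"
    have "compact (f ` K)"
      using K cont by (intro compact_continuous_image) (auto intro: continuous_on_subset)
    then have "closed ((\<lambda>s::real. of_real s * f z\<^sub>0) -` (f ` K))"
      by (intro closed_vimage compact_imp_closed continuous_intros)
    then have "compact T"
      unfolding T_def by (intro compact_Int_closed) auto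
    moreover have "1 \<in> T"
      using \<tau> K(2) by (auto simp: T_def)
    ultimately obtain t where t: "t \<in> T" and t_least: "\<And>s. s \<in> T \<Longrightarrow> t \<le> s"
      using compact_attains_inf[of T] by blast
    then obtain z where z: "z \<in> K" "f z = of_real t * f z\<^sub>0"
      by (auto simp: T_def)
    have "t = \<tau>"
    proof (rule ccontr)
      assume "t \<noteq> \<tau>"
      then have "\<tau> < t" "t \<le> 1" using t by (auto simp: T_def)
      then have "0 < t" using \<tau> by simp
      then have "z \<noteq> 0" using z(2) False \<open>f 0 = 0\<close> by auto
      then have "Re (z * deriv f z / f z) > 0"
        using pos z(1) K(1) by blast
      moreover have "z \<in> ball 0 r" using z(1) K(1) by blast
      ultimately obtain s z' where s: "\<tau> < s" "s < t" "norm z' < norm z"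
          "f z' = of_real s * f z\<^sub>0"
        using smaller_multiple_has_preimage[OF hol open_ball _ _ z(2) \<open>0 < t\<close> \<open>\<tau> < t\<close>] by blast
      then have "z' \<in> K" using z(1) by (auto simp: K_def)
      then have "of_real s * f z\<^sub>0 \<in> f ` K" using s(4) by (metis imageI)
      then have "s \<in> T" using s \<open>t \<le> 1\<close> by (auto simp: T_def)
      then show False using t_least s(2) by fastforce
    qed
    then have "x = f z" using z(2) x by simp
    then show ?thesis using z(1) K(1) by blast
  qed
qed

lemma norm_booth_lt_one:
  fixes w :: complex and r \<alpha> :: real
  assumes "norm w < r" "0 \<le> \<alpha>" "\<alpha> < (1 - r) / r\<^sup>2"
  shows "norm (w / (1 - of_real \<alpha> * w\<^sup>2)) < 1"
proof -
  have "0 < r" using assms(1) norm_ge_zero[of w] by linarith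
  then have "r + \<alpha> * r\<^sup>2 < 1"
    using assms(3) by (simp add: field_simps)
  moreover have "\<alpha> * (norm w)\<^sup>2 \<le> \<alpha> * r\<^sup>2"
    using assms by (intro mult_left_mono power_mono) auto
  ultimately have "norm w < 1 - \<alpha> * (norm w)\<^sup>2"
    using assms(1) by linarith
  also have "\<dots> \<le> norm (1 - of_real \<alpha> * w\<^sup>2)"
    using norm_triangle_ineq2[of 1 "of_real \<alpha> * w\<^sup>2"] \<open>0 \<le> \<alpha>\<close> by (simp add: norm_mult norm_power)
  finally show ?thesis
    using norm_ge_zero[of w] by (auto simp: norm_divide divide_less_eq_1 simp del: norm_ge_zero)
qed

theorem theorem2p2:
  fixes r \<alpha> :: real and f :: "complex \<Rightarrow> complex"
  assumes "0 < r" "r \<le> 1"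
    and "0 \<le> \<alpha>" "\<alpha> < 1" "\<alpha> < (1 - r) / r\<^sup>2"
    and "f \<in> class_BS \<alpha>"
  shows "starlike_domain (f ` {z. norm z < r})"
proof -
  have hol: "f holomorphic_on unit_disc" and f0: "f 0 = 0"
    using assms(6) by (auto simp: class_BS_def class_A_def)
  obtain w where w: "w holomorphic_on unit_disc" "w 0 = 0"
    and w_lt: "\<And>z. norm z < 1 \<Longrightarrow> norm (w z) < 1"
    and sub: "\<And>z. norm z < 1 \<Longrightarrow>
      log_quotient f z - 1 = w z / (1 - of_real \<alpha> * (w z)\<^sup>2)"
    using assms(6) by (auto simp: class_BS_def subordinate_def)
  have "starlike_domain (f ` ball 0 r)"
  proof (rule starlike_domain_image_ball)
    show "f holomorphic_on ball 0 r"
      using hol \<open>r \<le> 1\<close> by (auto intro: holomorphic_on_subset)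
    fix z :: complex assume z: "z \<in> ball 0 r" "z \<noteq> 0"
    then have z1: "norm z < 1" "norm z < r" using \<open>r \<le> 1\<close> by auto
    have "norm (w z) \<le> norm z"
      using Schwarz_Lemma(1)[OF w w_lt z1(1)] .
    then have "norm (log_quotient f z - 1) < 1"
      using norm_booth_lt_one[of "w z" r \<alpha>] z1 assms(3,5) sub by simp
    then have "Re (log_quotient f z) > 0"
      using abs_Re_le_cmod[of "log_quotient f z - 1"] by auto
    then show "Re (z * deriv f z / f z) > 0"
      using z(2) by (simp add: log_quotient_def)
  qed (use \<open>0 < r\<close> f0 in auto)
  moreover have "{z. norm z < r} = ball (0 :: complex) r"
    by auto
  ultimately show ?thesis by simp
qed

end
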